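(* Let $\mathcal{A}$ be a Banach algebra and let $X$ be a commutative Banach $\mathcal{A}$-bimodule. If the module extension $\mathcal{A}\oplus X$ has an ultra central approximate identity, then $\mathcal{A}$ has an ultra central approximate identity.
   Context: A Banach $\mathcal{A}$-bimodule $X$ is commutative if $ax=xa$ for all $a\in\mathcal{A}$, $x\in X$. The module extension $\mathcal{A}\oplus X$ is the Banach algebra with norm $\|(a,x)\|=\|a\|_{\mathcal{A}}+\|x\|_X$ and product $(a,x)(b,y)=(ab,\,ay+xb)$ for $a,b\in\mathcal{A}$, $x,y\in X$. A Banach algebra $\mathcal{C}$ has an ultra central approximate identity if there is a (not necessarily bounded) net $(e_\alpha)$ in $\mathcal{C}^{**}$ such that $ce_\alpha=e_\alpha c$ for all $\alpha$ and $e_\alpha c\to c$ in norm, for every $c\in\mathcal{C}$. (Second duals carry the first Arens product.) *)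

theory Defs
  imports "HOL-Analysis.Analysis"
begin

section \<open>Complex normed spaces and complex Banach algebras\<close>

class scaleC =
  fixes scaleC :: "complex \<Rightarrow> 'a \<Rightarrow> 'a" (infixr "*\<^sub>C" 75)

class complex_normed_vector = real_normed_vector + scaleC +
  assumes scaleC_add_right: "c *\<^sub>C (x + y) = c *\<^sub>C x + c *\<^sub>C y"
    and scaleC_add_left: "(c + d) *\<^sub>C x = c *\<^sub>C x + d *\<^sub>C x"
    and scaleC_scaleC: "c *\<^sub>C (d *\<^sub>C x) = (c * d) *\<^sub>C x"
    and scaleC_one: "1 *\<^sub>C x = x"
    and scaleR_scaleC: "r *\<^sub>R x = complex_of_real r *\<^sub>C x"
    and norm_scaleC: "norm (c *\<^sub>C x) = cmod c * norm x"

text \<open>Not necessarily unital; submultiplicativity of the norm comes from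
  \<^class>\<open>real_normed_algebra\<close>.\<close>

class complex_banach_algebra = complex_normed_vector + real_normed_algebra + banach +
  assumes scaleC_mult_left: "(c *\<^sub>C x) * y = c *\<^sub>C (x * y)"
    and scaleC_mult_right: "x * (c *\<^sub>C y) = c *\<^sub>C (x * y)"

instantiation complex :: complex_banach_algebra
begin

definition scaleC_complex :: "complex \<Rightarrow> complex \<Rightarrow> complex" where
  "scaleC_complex c x = c * x"

instance
  by standard (auto simp: scaleC_complex_def algebra_simps norm_mult scaleR_conv_of_real)

end


section \<open>The dual space\<close>

definition bounded_clinear_functional :: "('a::complex_normed_vector \<Rightarrow> complex) \<Rightarrow> bool" where
  "bounded_clinear_functional f \<longleftrightarrow> bounded_linear f \<and> (\<forall>c x. f (c *\<^sub>C x) = c * f x)"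

lemma bounded_clinear_functional_0: "bounded_clinear_functional (\<lambda>x. 0)"
  by (simp add: bounded_clinear_functional_def)

typedef (overloaded) 'a dual = "{f :: 'a::complex_normed_vector \<Rightarrow> complex. bounded_clinear_functional f}"
  morphisms dual_apply Dual
  using bounded_clinear_functional_0 by blast

setup_lifting type_definition_dual

lemma dual_eqI: "(\<And>x. dual_apply f x = dual_apply g x) \<Longrightarrow> f = g"
  by (metis dual_apply_inject ext)

lemma bounded_linear_dual_apply: "bounded_linear (dual_apply f)"
  using dual_apply[of f] by (simp add: bounded_clinear_functional_def)

lemma dual_apply_scaleC: "dual_apply f (c *\<^sub>C x) = c * dual_apply f x"
  using dual_apply[of f] by (simp add: bounded_clinear_functional_def)

lemma onorm_cmult:
  assumes "bounded_linear (f :: 'a::real_normed_vector \<Rightarrow> complex)"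
  shows "onorm (\<lambda>x. c * f x) = cmod c * onorm f"
proof -
  have "onorm (\<lambda>x. c * f x) = onorm (\<lambda>x. cmod c *\<^sub>R f x)"
    by (simp add: onorm_def norm_mult)
  also have "\<dots> = cmod c * onorm f"
    using onorm_scaleR[OF assms] by simp
  finally show ?thesis .
qed

instantiation dual :: (complex_normed_vector) complex_normed_vector
begin

lift_definition zero_dual :: "'a dual" is "\<lambda>x. 0"
  by (rule bounded_clinear_functional_0)

lift_definition plus_dual :: "'a dual \<Rightarrow> 'a dual \<Rightarrow> 'a dual" is "\<lambda>f g x. f x + g x"
  by (auto simp: bounded_clinear_functional_def bounded_linear_add distrib_left)

lift_definition minus_dual :: "'a dual \<Rightarrow> 'a dual \<Rightarrow> 'a dual" is "\<lambda>f g x. f x - g x"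
  by (auto simp: bounded_clinear_functional_def bounded_linear_sub right_diff_distrib)

lift_definition uminus_dual :: "'a dual \<Rightarrow> 'a dual" is "\<lambda>f x. - f x"
  by (auto simp: bounded_clinear_functional_def bounded_linear_minus)

lift_definition scaleC_dual :: "complex \<Rightarrow> 'a dual \<Rightarrow> 'a dual" is "\<lambda>c f x. c * f x"
  by (auto simp: bounded_clinear_functional_def bounded_linear_const_mult)

definition scaleR_dual :: "real \<Rightarrow> 'a dual \<Rightarrow> 'a dual" where
  "scaleR_dual r f = complex_of_real r *\<^sub>C f"

lift_definition norm_dual :: "'a dual \<Rightarrow> real" is onorm .

definition dist_dual :: "'a dual \<Rightarrow> 'a dual \<Rightarrow> real" where
  "dist_dual f g = norm (f - g)"

definition sgn_dual :: "'a dual \<Rightarrow> 'a dual" where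
  "sgn_dual f = inverse (norm f) *\<^sub>R f"

definition uniformity_dual :: "('a dual \<times> 'a dual) filter" where
  "uniformity_dual = (INF e\<in>{0 <..}. principal {(x, y). dist x y < e})"

definition open_dual :: "'a dual set \<Rightarrow> bool" where
  "open_dual S \<longleftrightarrow> (\<forall>x\<in>S. \<forall>\<^sub>F (x', y) in uniformity. x' = x \<longrightarrow> y \<in> S)"

instance
proof
  fix f g h :: "'a dual" and r s :: real and c d :: complex
  show "f + g + h = f + (g + h)" by transfer (simp add: add.assoc)
  show "f + g = g + f" by transfer (simp add: add.commute)
  show "0 + f = f" by transfer simp
  show "- f + f = 0" by transfer simp
  show "f - g = f + - g" by transfer simp
  show "c *\<^sub>C (f + g) = c *\<^sub>C f + c *\<^sub>C g" by transfer (simp add: distrib_left)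
  show "(c + d) *\<^sub>C f = c *\<^sub>C f + d *\<^sub>C f" by transfer (simp add: distrib_right)
  show "c *\<^sub>C (d *\<^sub>C f) = (c * d) *\<^sub>C f" by transfer (simp add: mult.assoc)
  show "1 *\<^sub>C f = f" by transfer simp
  show "r *\<^sub>R f = complex_of_real r *\<^sub>C f" by (rule scaleR_dual_def)
  show "r *\<^sub>R (f + g) = r *\<^sub>R f + r *\<^sub>R g"
    unfolding scaleR_dual_def by transfer (simp add: distrib_left)
  show "(r + s) *\<^sub>R f = r *\<^sub>R f + s *\<^sub>R f"
    unfolding scaleR_dual_def by transfer (simp add: distrib_right)
  show "r *\<^sub>R (s *\<^sub>R f) = (r * s) *\<^sub>R f"
    unfolding scaleR_dual_def by transfer (simp add: mult.assoc)
  show "1 *\<^sub>R f = f"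
    unfolding scaleR_dual_def by transfer simp
  show norm_c: "norm (c *\<^sub>C f) = cmod c * norm f" for c and f :: "'a dual"
    by transfer (simp add: bounded_clinear_functional_def onorm_cmult)
  show "norm (r *\<^sub>R f) = \<bar>r\<bar> * norm f"
    unfolding scaleR_dual_def by (simp add: norm_c)
  show "dist f g = norm (f - g)" by (rule dist_dual_def)
  show "sgn f = inverse (norm f) *\<^sub>R f" by (rule sgn_dual_def)
  show "uniformity = (INF e\<in>{0 <..}. principal {(x :: 'a dual, y). dist x y < e})"
    by (rule uniformity_dual_def)
  show "open U \<longleftrightarrow> (\<forall>x\<in>U. \<forall>\<^sub>F (x', y) in uniformity. x' = x \<longrightarrow> y \<in> U)" for U :: "'a dual set"
    by (rule open_dual_def)
  show "norm f = 0 \<longleftrightarrow> f = 0"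
    by transfer (auto simp: bounded_clinear_functional_def onorm_eq_0 fun_eq_iff)
  show "norm (f + g) \<le> norm f + norm g"
    by transfer (auto simp: bounded_clinear_functional_def intro: onorm_triangle)
qed

end

lemma norm_dual_apply_le: "cmod (dual_apply f x) \<le> norm f * norm x"
  by (simp add: norm_dual.rep_eq onorm bounded_linear_dual_apply)

lift_definition bidual_embed :: "'a::complex_normed_vector \<Rightarrow> 'a dual dual" is
  "\<lambda>c f. dual_apply f c"
  unfolding bounded_clinear_functional_def
proof (intro conjI allI)
  show "bounded_linear (\<lambda>f. dual_apply f c)" for c :: 'a
  proof
    show "dual_apply (f + g) c = dual_apply f c + dual_apply g c" for f g
      by (simp add: plus_dual.rep_eq)
    show "dual_apply (r *\<^sub>R f) c = r *\<^sub>R dual_apply f c" for r f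
      by (simp add: scaleR_dual_def scaleC_dual.rep_eq scaleR_conv_of_real)
    show "\<exists>K. \<forall>f. cmod (dual_apply f c) \<le> norm f * K"
      using norm_dual_apply_le by blast
  qed
qed (simp add: scaleC_dual.rep_eq)


section \<open>The first Arens product\<close>

text \<open>The multiplication of an algebra is passed as a parameter \<open>m\<close>, since that of a module
  extension depends on the module actions and not on the types alone.  For a functional \<open>f\<close>,
  \<open>(f \<cdot> a)(b) = f (ab)\<close>; for \<open>\<Psi>\<close> in the second dual, \<open>(\<Psi> \<cdot> f)(a) = \<Psi> (f \<cdot> a)\<close>; and
  \<open>(\<Phi> \<box> \<Psi>)(f) = \<Phi> (\<Psi> \<cdot> f)\<close>.  The arguments of \<^const>\<open>Dual\<close> are bounded functionals whenever
  \<open>m\<close> is a bounded complex bilinear map, see \<open>dual_apply_arens\<close> below.\<close>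

definition dual_act :: "('c::complex_normed_vector \<Rightarrow> 'c \<Rightarrow> 'c) \<Rightarrow> 'c dual \<Rightarrow> 'c \<Rightarrow> 'c dual" where
  "dual_act m f a = Dual (\<lambda>b. dual_apply f (m a b))"

definition bidual_act ::
  "('c::complex_normed_vector \<Rightarrow> 'c \<Rightarrow> 'c) \<Rightarrow> 'c dual dual \<Rightarrow> 'c dual \<Rightarrow> 'c dual" where
  "bidual_act m \<Psi> f = Dual (\<lambda>a. dual_apply \<Psi> (dual_act m f a))"

definition arens ::
  "('c::complex_normed_vector \<Rightarrow> 'c \<Rightarrow> 'c) \<Rightarrow> 'c dual dual \<Rightarrow> 'c dual dual \<Rightarrow> 'c dual dual" where
  "arens m \<Phi> \<Psi> = Dual (\<lambda>f. dual_apply \<Phi> (bidual_act m \<Psi> f))"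

definition bounded_cbilinear ::
  "('a::complex_normed_vector \<Rightarrow> 'b::complex_normed_vector \<Rightarrow> 'c::complex_normed_vector) \<Rightarrow> bool" where
  "bounded_cbilinear m \<longleftrightarrow> bounded_bilinear m \<and>
     (\<forall>c a b. m (c *\<^sub>C a) b = c *\<^sub>C m a b) \<and> (\<forall>c a b. m a (c *\<^sub>C b) = c *\<^sub>C m a b)"

lemma Dual_inverse_bound:
  assumes "\<And>x y. f (x + y) = f x + f y" "\<And>c x. f (c *\<^sub>C x) = c * f x"
    and "\<And>x. cmod (f x) \<le> norm x * K"
  shows "dual_apply (Dual f) = f"
proof (rule Dual_inverse)
  have "bounded_linear f"
    by (rule bounded_linear_intro[where K = K])
      (use assms in \<open>auto simp: scaleR_scaleC scaleC_complex_def\<close>)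
  then show "f \<in> {f. bounded_clinear_functional f}"
    using assms by (simp add: bounded_clinear_functional_def)
qed

lemma norm_dual_le:
  assumes "0 \<le> K" "\<And>x. cmod (dual_apply f x) \<le> K * norm x"
  shows "norm f \<le> K"
  unfolding norm_dual.rep_eq using onorm_bound[OF assms] .

lemma dual_apply_add: "dual_apply f (x + y) = dual_apply f x + dual_apply f y"
  using bounded_linear_dual_apply linear_simps(1) by blast

context
  fixes m :: "'c::complex_normed_vector \<Rightarrow> 'c \<Rightarrow> 'c" and K :: real
  assumes m: "bounded_cbilinear m"
    and K: "0 \<le> K" "\<And>a b. norm (m a b) \<le> norm a * norm b * K"
begin

lemma m_simps:
  "m (a + a') b = m a b + m a' b" "m a (b + b') = m a b + m a b'"
  "m (c *\<^sub>C a) b = c *\<^sub>C m a b" "m a (c *\<^sub>C b) = c *\<^sub>C m a b"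
  using m by (auto simp: bounded_cbilinear_def bounded_bilinear.add_left bounded_bilinear.add_right)

lemma m_bound: "cmod (dual_apply f (m a b)) \<le> norm f * norm a * K * norm b"
proof -
  have "cmod (dual_apply f (m a b)) \<le> norm f * norm (m a b)" by (rule norm_dual_apply_le)
  also have "\<dots> \<le> norm f * (norm a * norm b * K)" by (intro mult_left_mono K) simp
  finally show ?thesis by (simp add: mult_ac)
qed

lemma dual_apply_dual_act_aux: "dual_apply (dual_act m f a) = (\<lambda>b. dual_apply f (m a b))"
  unfolding dual_act_def
  by (rule Dual_inverse_bound[where K = "norm f * norm a * K"])
    (use m_bound[of f a] in \<open>auto simp: m_simps dual_apply_add dual_apply_scaleC mult_ac\<close>)

lemma norm_dual_act: "norm (dual_act m f a) \<le> norm f * norm a * K"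
  by (rule norm_dual_le) (auto simp: dual_apply_dual_act_aux K m_bound)

lemma bidual_bound: "cmod (dual_apply \<Psi> (dual_act m f a)) \<le> norm \<Psi> * norm f * K * norm a"
proof -
  have "cmod (dual_apply \<Psi> (dual_act m f a)) \<le> norm \<Psi> * norm (dual_act m f a)"
    by (rule norm_dual_apply_le)
  also have "\<dots> \<le> norm \<Psi> * (norm f * norm a * K)"
    by (intro mult_left_mono norm_dual_act) simp
  finally show ?thesis by (simp add: mult_ac)
qed

lemma dual_act_simps:
  "dual_act m f (a + a') = dual_act m f a + dual_act m f a'"
  "dual_act m (f + f') a = dual_act m f a + dual_act m f' a"
  "dual_act m f (c *\<^sub>C a) = c *\<^sub>C dual_act m f a"
  "dual_act m (c *\<^sub>C f) a = c *\<^sub>C dual_act m f a"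
  by (auto intro!: dual_eqI simp: dual_apply_dual_act_aux plus_dual.rep_eq scaleC_dual.rep_eq
      m_simps dual_apply_add dual_apply_scaleC)

lemma dual_apply_bidual_act_aux:
  "dual_apply (bidual_act m \<Psi> f) = (\<lambda>a. dual_apply \<Psi> (dual_act m f a))"
  unfolding bidual_act_def
  by (rule Dual_inverse_bound[where K = "norm \<Psi> * norm f * K"])
    (use bidual_bound in \<open>auto simp: dual_act_simps dual_apply_add dual_apply_scaleC mult_ac\<close>)

lemma norm_bidual_act: "norm (bidual_act m \<Psi> f) \<le> norm \<Psi> * norm f * K"
  by (rule norm_dual_le) (auto simp: dual_apply_bidual_act_aux K bidual_bound)

lemma bidual_act_simps:
  "bidual_act m \<Psi> (f + f') = bidual_act m \<Psi> f + bidual_act m \<Psi> f'"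
  "bidual_act m \<Psi> (c *\<^sub>C f) = c *\<^sub>C bidual_act m \<Psi> f"
  by (auto intro!: dual_eqI simp: dual_apply_bidual_act_aux dual_act_simps plus_dual.rep_eq
      scaleC_dual.rep_eq dual_apply_add dual_apply_scaleC)

lemma dual_apply_arens_aux: "dual_apply (arens m \<Phi> \<Psi>) = (\<lambda>f. dual_apply \<Phi> (bidual_act m \<Psi> f))"
  unfolding arens_def
proof (rule Dual_inverse_bound[where K = "norm \<Phi> * norm \<Psi> * K"])
  fix f
  have "cmod (dual_apply \<Phi> (bidual_act m \<Psi> f)) \<le> norm \<Phi> * norm (bidual_act m \<Psi> f)"
    by (rule norm_dual_apply_le)
  also have "\<dots> \<le> norm \<Phi> * (norm \<Psi> * norm f * K)"
    by (intro mult_left_mono norm_bidual_act) simp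
  finally show "cmod (dual_apply \<Phi> (bidual_act m \<Psi> f)) \<le> norm f * (norm \<Phi> * norm \<Psi> * K)"
    by (simp add: mult_ac)
qed (auto simp: bidual_act_simps dual_apply_add dual_apply_scaleC)

end

lemma bounded_cbilinear_bound:
  assumes "bounded_cbilinear m"
  obtains K where "0 \<le> K" "\<And>a b. norm (m a b) \<le> norm a * norm b * K"
proof -
  have "bounded_bilinear m" using assms by (simp add: bounded_cbilinear_def)
  from bounded_bilinear.nonneg_bounded[OF this] show thesis using that by metis
qed

lemma dual_apply_dual_act:
  assumes "bounded_cbilinear m"
  shows "dual_apply (dual_act m f a) b = dual_apply f (m a b)"
proof -
  obtain K where "0 \<le> K" "\<And>a b. norm (m a b) \<le> norm a * norm b * K"
    by (rule bounded_cbilinear_bound[OF assms]) auto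
  from dual_apply_dual_act_aux[OF assms this] show ?thesis by simp
qed

lemma dual_apply_bidual_act:
  assumes "bounded_cbilinear m"
  shows "dual_apply (bidual_act m \<Psi> f) a = dual_apply \<Psi> (dual_act m f a)"
proof -
  obtain K where "0 \<le> K" "\<And>a b. norm (m a b) \<le> norm a * norm b * K"
    by (rule bounded_cbilinear_bound[OF assms]) auto
  from dual_apply_bidual_act_aux[OF assms this] show ?thesis by simp
qed

lemma dual_apply_arens:
  assumes "bounded_cbilinear m"
  shows "dual_apply (arens m \<Phi> \<Psi>) f = dual_apply \<Phi> (bidual_act m \<Psi> f)"
proof -
  obtain K where "0 \<le> K" "\<And>a b. norm (m a b) \<le> norm a * norm b * K"
    by (rule bounded_cbilinear_bound[OF assms]) auto
  from dual_apply_arens_aux[OF assms this] show ?thesis by simp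
qed

lemma bounded_cbilinear_times: "bounded_cbilinear ((*) :: 'a::complex_banach_algebra \<Rightarrow> 'a \<Rightarrow> 'a)"
  by (simp add: bounded_cbilinear_def bounded_bilinear_mult scaleC_mult_left scaleC_mult_right)


section \<open>Nets and ultra central approximate identities\<close>

definition directed_set :: "'i set \<Rightarrow> ('i \<Rightarrow> 'i \<Rightarrow> bool) \<Rightarrow> bool" where
  "directed_set I le \<longleftrightarrow> I \<noteq> {} \<and> (\<forall>i\<in>I. le i i) \<and>
     (\<forall>i\<in>I. \<forall>j\<in>I. \<forall>k\<in>I. le i j \<longrightarrow> le j k \<longrightarrow> le i k) \<and>
     (\<forall>i\<in>I. \<forall>j\<in>I. \<exists>k\<in>I. le i k \<and> le j k)"

definition tail_filter :: "'i set \<Rightarrow> ('i \<Rightarrow> 'i \<Rightarrow> bool) \<Rightarrow> 'i filter" where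
  "tail_filter I le = (INF i\<in>I. principal {j\<in>I. le i j})"

lemma eventually_tail_filter:
  assumes "directed_set I le"
  shows "eventually P (tail_filter I le) \<longleftrightarrow> (\<exists>i\<in>I. \<forall>j\<in>I. le i j \<longrightarrow> P j)"
proof -
  have "eventually P (tail_filter I le) \<longleftrightarrow> (\<exists>i\<in>I. eventually P (principal {j\<in>I. le i j}))"
    unfolding tail_filter_def
  proof (rule eventually_INF_base)
    show "I \<noteq> {}" using assms by (simp add: directed_set_def)
    fix i j assume ij: "i \<in> I" "j \<in> I"
    then obtain k where "k \<in> I" "le i k" "le j k"
      using assms unfolding directed_set_def by blast
    moreover from this ij have "{l\<in>I. le k l} \<subseteq> {l\<in>I. le i l} \<inter> {l\<in>I. le j l}"
      using assms unfolding directed_set_def by blast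
    ultimately show "\<exists>k\<in>I. principal {l\<in>I. le k l}
        \<le> inf (principal {l\<in>I. le i l}) (principal {l\<in>I. le j l})"
      by auto
  qed
  then show ?thesis by (auto simp: eventually_principal)
qed

text \<open>HOL cannot quantify over the index type of a net inside a formula, so it is a parameter
  here: the predicate says that there is such a net over a directed subset of the type \<open>'i\<close>.\<close>

definition has_ultra_central_approximate_identity ::
  "'i itself \<Rightarrow> ('c::complex_normed_vector \<Rightarrow> 'c \<Rightarrow> 'c) \<Rightarrow> bool" where
  "has_ultra_central_approximate_identity (_ :: 'i itself) m \<longleftrightarrow>
     (\<exists>(I :: 'i set) le (e :: 'i \<Rightarrow> 'c dual dual).
        directed_set I le \<and>
        (\<forall>\<alpha>\<in>I. \<forall>c. arens m (bidual_embed c) (e \<alpha>) = arens m (e \<alpha>) (bidual_embed c)) \<and>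
        (\<forall>c. ((\<lambda>\<alpha>. arens m (e \<alpha>) (bidual_embed c)) \<longlongrightarrow> bidual_embed c) (tail_filter I le)))"


section \<open>Bimodules and module extensions\<close>

text \<open>The actions are bounded bilinear maps, not necessarily contractive.  The product of the
  module extension is then jointly continuous; if the actions are contractive, it is
  submultiplicative for the sum norm.\<close>

definition banach_bimodule ::
  "('a::complex_banach_algebra \<Rightarrow> 'x::{complex_normed_vector, banach} \<Rightarrow> 'x) \<Rightarrow>
   ('x \<Rightarrow> 'a \<Rightarrow> 'x) \<Rightarrow> bool" where
  "banach_bimodule lact ract \<longleftrightarrow>
     bounded_cbilinear lact \<and> bounded_cbilinear ract \<and>
     (\<forall>a b x. lact (a * b) x = lact a (lact b x)) \<and>
     (\<forall>a b x. ract x (a * b) = ract (ract x a) b) \<and>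
     (\<forall>a b x. ract (lact a x) b = lact a (ract x b))"

definition commutative_banach_bimodule ::
  "('a::complex_banach_algebra \<Rightarrow> 'x::{complex_normed_vector, banach} \<Rightarrow> 'x) \<Rightarrow>
   ('x \<Rightarrow> 'a \<Rightarrow> 'x) \<Rightarrow> bool" where
  "commutative_banach_bimodule lact ract \<longleftrightarrow>
     banach_bimodule lact ract \<and> (\<forall>a x. lact a x = ract x a)"

text \<open>A type of its own rather than the product type, whose norm in the library is Euclidean.\<close>

datatype ('a, 'x) module_ext = Ext (ext_alg: 'a) (ext_mod: 'x)

instantiation module_ext :: (complex_normed_vector, complex_normed_vector) complex_normed_vector
begin

definition zero_module_ext :: "('a, 'b) module_ext" where
  "0 = Ext 0 0"

definition plus_module_ext :: "('a, 'b) module_ext \<Rightarrow> ('a, 'b) module_ext \<Rightarrow> ('a, 'b) module_ext" where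
  "u + v = Ext (ext_alg u + ext_alg v) (ext_mod u + ext_mod v)"

definition minus_module_ext :: "('a, 'b) module_ext \<Rightarrow> ('a, 'b) module_ext \<Rightarrow> ('a, 'b) module_ext" where
  "u - v = Ext (ext_alg u - ext_alg v) (ext_mod u - ext_mod v)"

definition uminus_module_ext :: "('a, 'b) module_ext \<Rightarrow> ('a, 'b) module_ext" where
  "- u = Ext (- ext_alg u) (- ext_mod u)"

definition scaleC_module_ext :: "complex \<Rightarrow> ('a, 'b) module_ext \<Rightarrow> ('a, 'b) module_ext" where
  "c *\<^sub>C u = Ext (c *\<^sub>C ext_alg u) (c *\<^sub>C ext_mod u)"

definition scaleR_module_ext :: "real \<Rightarrow> ('a, 'b) module_ext \<Rightarrow> ('a, 'b) module_ext" where
  "r *\<^sub>R u = Ext (r *\<^sub>R ext_alg u) (r *\<^sub>R ext_mod u)"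

definition norm_module_ext :: "('a, 'b) module_ext \<Rightarrow> real" where
  "norm u = norm (ext_alg u) + norm (ext_mod u)"

definition dist_module_ext :: "('a, 'b) module_ext \<Rightarrow> ('a, 'b) module_ext \<Rightarrow> real" where
  "dist_module_ext u v = norm (u - v)"

definition sgn_module_ext :: "('a, 'b) module_ext \<Rightarrow> ('a, 'b) module_ext" where
  "sgn_module_ext u = inverse (norm u) *\<^sub>R u"

definition uniformity_module_ext :: "(('a, 'b) module_ext \<times> ('a, 'b) module_ext) filter" where
  "uniformity_module_ext = (INF e\<in>{0 <..}. principal {(x, y). dist x y < e})"

definition open_module_ext :: "('a, 'b) module_ext set \<Rightarrow> bool" where
  "open_module_ext S \<longleftrightarrow> (\<forall>x\<in>S. \<forall>\<^sub>F (x', y) in uniformity. x' = x \<longrightarrow> y \<in> S)"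

instance
proof
  fix u v w :: "('a, 'b) module_ext" and r s :: real and c d :: complex
  note defs = zero_module_ext_def plus_module_ext_def minus_module_ext_def uminus_module_ext_def
    scaleC_module_ext_def scaleR_module_ext_def norm_module_ext_def
  show "u + v + w = u + (v + w)" by (simp add: defs add.assoc)
  show "u + v = v + u" by (simp add: defs add.commute)
  show "0 + u = u" by (simp add: defs)
  show "- u + u = 0" by (simp add: defs)
  show "u - v = u + - v" by (simp add: defs)
  show "c *\<^sub>C (u + v) = c *\<^sub>C u + c *\<^sub>C v" by (simp add: defs scaleC_add_right)
  show "(c + d) *\<^sub>C u = c *\<^sub>C u + d *\<^sub>C u" by (simp add: defs scaleC_add_left)
  show "c *\<^sub>C (d *\<^sub>C u) = (c * d) *\<^sub>C u" by (simp add: defs scaleC_scaleC)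
  show "1 *\<^sub>C u = u" by (simp add: defs scaleC_one)
  show "r *\<^sub>R u = complex_of_real r *\<^sub>C u" by (simp add: defs scaleR_scaleC)
  show "norm (c *\<^sub>C u) = cmod c * norm u" by (simp add: defs norm_scaleC distrib_left)
  show "r *\<^sub>R (u + v) = r *\<^sub>R u + r *\<^sub>R v" by (simp add: defs scaleR_add_right)
  show "(r + s) *\<^sub>R u = r *\<^sub>R u + s *\<^sub>R u" by (simp add: defs scaleR_add_left)
  show "r *\<^sub>R (s *\<^sub>R u) = (r * s) *\<^sub>R u" by (simp add: defs)
  show "1 *\<^sub>R u = u" by (simp add: defs)
  show "norm (r *\<^sub>R u) = \<bar>r\<bar> * norm u" by (simp add: defs distrib_left)
  show "dist u v = norm (u - v)" by (rule dist_module_ext_def)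
  show "sgn u = inverse (norm u) *\<^sub>R u" by (rule sgn_module_ext_def)
  show "uniformity = (INF e\<in>{0 <..}. principal {(x :: ('a, 'b) module_ext, y). dist x y < e})"
    by (rule uniformity_module_ext_def)
  show "open U \<longleftrightarrow> (\<forall>x\<in>U. \<forall>\<^sub>F (x', y) in uniformity. x' = x \<longrightarrow> y \<in> U)"
    for U :: "('a, 'b) module_ext set"
    by (rule open_module_ext_def)
  show "norm u = 0 \<longleftrightarrow> u = 0"
    by (cases u) (auto simp: defs add_nonneg_eq_0_iff)
  show "norm (u + v) \<le> norm u + norm v"
    using norm_triangle_ineq[of "ext_alg u" "ext_alg v"] norm_triangle_ineq[of "ext_mod u" "ext_mod v"]
    by (simp add: defs)
qed

end

instance module_ext :: ("{complex_normed_vector, banach}", "{complex_normed_vector, banach}") banach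
proof
  fix X :: "nat \<Rightarrow> ('a, 'b) module_ext"
  assume X: "Cauchy X"
  have alg_lin: "bounded_linear (ext_alg :: ('a, 'b) module_ext \<Rightarrow> 'a)"
    by (rule bounded_linear_intro[where K = 1])
      (auto simp: plus_module_ext_def scaleR_module_ext_def norm_module_ext_def)
  obtain a where a: "(\<lambda>n. ext_alg (X n)) \<longlonglongrightarrow> a"
    using Cauchy_convergent[OF bounded_linear.Cauchy[OF alg_lin X]] unfolding convergent_def by auto
  have mod_lin: "bounded_linear (ext_mod :: ('a, 'b) module_ext \<Rightarrow> 'b)"
    by (rule bounded_linear_intro[where K = 1])
      (auto simp: plus_module_ext_def scaleR_module_ext_def norm_module_ext_def)
  obtain x where x: "(\<lambda>n. ext_mod (X n)) \<longlonglongrightarrow> x"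
    using Cauchy_convergent[OF bounded_linear.Cauchy[OF mod_lin X]] unfolding convergent_def by auto
  have "(\<lambda>n. norm (ext_alg (X n) - a) + norm (ext_mod (X n) - x)) \<longlonglongrightarrow> 0 + 0"
    by (intro tendsto_add tendsto_norm_zero LIM_zero a x)
  then have "(\<lambda>n. norm (X n - Ext a x)) \<longlonglongrightarrow> 0"
    by (simp add: norm_module_ext_def minus_module_ext_def)
  then have "X \<longlonglongrightarrow> Ext a x"
    using LIM_zero_cancel tendsto_norm_zero_iff by blast
  then show "convergent X" by (rule convergentI)
qed

definition module_ext_mult ::
  "('a::complex_banach_algebra \<Rightarrow> 'x \<Rightarrow> 'x) \<Rightarrow> ('x \<Rightarrow> 'a \<Rightarrow> 'x) \<Rightarrow>
   ('a, 'x::{complex_normed_vector, banach}) module_ext \<Rightarrow> ('a, 'x) module_ext \<Rightarrow> ('a, 'x) module_ext" where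
  "module_ext_mult lact ract u v =
     Ext (ext_alg u * ext_alg v) (lact (ext_alg u) (ext_mod v) + ract (ext_mod u) (ext_alg v))"

lemma module_ext_mult_assoc:
  assumes "banach_bimodule lact ract"
  shows "module_ext_mult lact ract (module_ext_mult lact ract u v) w =
    module_ext_mult lact ract u (module_ext_mult lact ract v w)"
proof -
  have "bounded_bilinear lact" "bounded_bilinear ract"
    using assms by (auto simp: banach_bimodule_def bounded_cbilinear_def)
  with assms show ?thesis
    by (simp add: module_ext_mult_def banach_bimodule_def mult.assoc add.assoc
        bounded_bilinear.add_left bounded_bilinear.add_right)
qed

lemma bounded_cbilinear_module_ext_mult:
  assumes "banach_bimodule lact ract"
  shows "bounded_cbilinear (module_ext_mult lact ract)"
proof -
  have l: "bounded_cbilinear lact" and r: "bounded_cbilinear ract"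
    using assms by (auto simp: banach_bimodule_def)
  have bl: "bounded_bilinear lact" and br: "bounded_bilinear ract"
    using l r by (auto simp: bounded_cbilinear_def)
  obtain K where K: "0 \<le> K" "\<And>a x. norm (lact a x) \<le> norm a * norm x * K"
    by (rule bounded_cbilinear_bound[OF l]) auto
  obtain L where L: "0 \<le> L" "\<And>a x. norm (ract x a) \<le> norm x * norm a * L"
    by (rule bounded_cbilinear_bound[OF r]) auto
  note defs = module_ext_mult_def plus_module_ext_def scaleR_module_ext_def scaleC_module_ext_def
  have bound: "norm (module_ext_mult lact ract u v) \<le> norm u * norm v * (1 + K + L)" for u v
  proof -
    let ?a = "norm (ext_alg u)" and ?x = "norm (ext_mod u)"
    let ?b = "norm (ext_alg v)" and ?y = "norm (ext_mod v)"
    have p: "?a * ?b \<le> norm u * norm v" "?a * ?y \<le> norm u * norm v" "?x * ?b \<le> norm u * norm v"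
      by (auto simp: norm_module_ext_def intro!: mult_mono)
    have "norm (module_ext_mult lact ract u v)
        \<le> norm (ext_alg u * ext_alg v) + (norm (lact (ext_alg u) (ext_mod v))
          + norm (ract (ext_mod u) (ext_alg v)))"
      by (simp add: norm_module_ext_def module_ext_mult_def norm_triangle_ineq)
    also have "\<dots> \<le> ?a * ?b + (?a * ?y * K + ?x * ?b * L)"
      by (intro add_mono K L norm_mult_ineq)
    also have "\<dots> \<le> norm u * norm v + (norm u * norm v * K + norm u * norm v * L)"
      by (intro add_mono mult_right_mono p K L)
    finally show ?thesis by (simp add: distrib_left)
  qed
  have "bounded_bilinear (module_ext_mult lact ract)"
  proof
    show "\<exists>K. \<forall>u v. norm (module_ext_mult lact ract u v) \<le> norm u * norm v * K"
      using bound by blast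
  qed (auto simp: defs bounded_bilinear.add_left[OF bl] bounded_bilinear.add_right[OF bl]
      bounded_bilinear.add_left[OF br] bounded_bilinear.add_right[OF br]
      bounded_bilinear.scaleR_left[OF bl] bounded_bilinear.scaleR_right[OF bl]
      bounded_bilinear.scaleR_left[OF br] bounded_bilinear.scaleR_right[OF br]
      distrib_left distrib_right scaleR_add_right)
  then show ?thesis
    using l r unfolding bounded_cbilinear_def
    by (auto simp: defs scaleC_mult_left scaleC_mult_right scaleC_add_right)
qed

end

theory Submission
  imports Defs
begin

text \<open>The property passes to every image under a bounded surjective homomorphism
  \<open>T\<close>, and the coordinate projection of the module extension onto the algebra is one.
  Since \<open>T\<close> is multiplicative, its second adjoint \<open>T\<^sup>*\<^sup>*\<close> is multiplicative for the first Arens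
  products (\<open>second_dual_map_arens\<close>), and it extends \<open>T\<close> (\<open>second_dual_map_bidual_embed\<close>).
  Identify elements of an algebra with their images in its second dual.  Applying \<open>T\<^sup>*\<^sup>*\<close> to
  an ultra central net \<open>(e\<^sub>\<alpha>)\<close> turns \<open>c \<box> e\<^sub>\<alpha> = e\<^sub>\<alpha> \<box> c\<close> into
  \<open>T c \<box> T\<^sup>*\<^sup>* e\<^sub>\<alpha> = T\<^sup>*\<^sup>* e\<^sub>\<alpha> \<box> T c\<close> and, by norm continuity, the convergence of
  \<open>e\<^sub>\<alpha> \<box> c\<close> to \<open>c\<close> into that of \<open>T\<^sup>*\<^sup>* e\<^sub>\<alpha> \<box> T c\<close> to \<open>T c\<close>; by surjectivity, every element of
  the image algebra is some \<open>T c\<close>.  So \<open>(T\<^sup>*\<^sup>* e\<^sub>\<alpha>)\<close> is a net as required, over the same index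
  set (\<open>has_ultra_central_approximate_identity_surj_hom\<close>).\<close>

definition bounded_clinear :: "('a::complex_normed_vector \<Rightarrow> 'b::complex_normed_vector) \<Rightarrow> bool" where
  "bounded_clinear T \<longleftrightarrow> bounded_linear T \<and> (\<forall>c x. T (c *\<^sub>C x) = c *\<^sub>C T x)"

text \<open>The Banach space adjoint, written \<open>T\<^sup>*\<close> in the comments.\<close>

definition dual_map :: "('a::complex_normed_vector \<Rightarrow> 'b::complex_normed_vector) \<Rightarrow> 'b dual \<Rightarrow> 'a dual" where
  "dual_map T f = Dual (\<lambda>x. dual_apply f (T x))"

lemma dual_apply_dual_map:
  assumes "bounded_clinear T"
  shows "dual_apply (dual_map T f) x = dual_apply f (T x)"
proof -
  have "bounded_linear (\<lambda>x. dual_apply f (T x))"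
    using assms unfolding bounded_clinear_def
    by (intro bounded_linear_compose[OF bounded_linear_dual_apply]) simp
  then have "bounded_clinear_functional (\<lambda>x. dual_apply f (T x))"
    using assms by (simp add: bounded_clinear_functional_def bounded_clinear_def dual_apply_scaleC)
  then show ?thesis
    by (simp add: dual_map_def Dual_inverse)
qed

lemma bounded_clinear_dual_map:
  assumes T: "bounded_clinear T"
  shows "bounded_clinear (dual_map T)"
proof -
  note [simp] = dual_apply_dual_map[OF T] plus_dual.rep_eq scaleC_dual.rep_eq
  have scaleC: "dual_map T (c *\<^sub>C f) = c *\<^sub>C dual_map T f" for c f
    by (rule dual_eqI) simp
  obtain K where K: "K > 0" "\<And>x. norm (T x) \<le> norm x * K"
    using T bounded_linear.pos_bounded unfolding bounded_clinear_def by blast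
  have "norm (dual_map T f) \<le> norm f * K" for f
  proof (rule norm_dual_le)
    show "0 \<le> norm f * K" using K(1) by simp
    fix x
    have "cmod (dual_apply f (T x)) \<le> norm f * norm (T x)" by (rule norm_dual_apply_le)
    also have "\<dots> \<le> norm f * (norm x * K)" by (intro mult_left_mono K) simp
    finally show "cmod (dual_apply (dual_map T f) x) \<le> norm f * K * norm x"
      by (simp add: mult_ac)
  qed
  then have "bounded_linear (dual_map T)"
    by (intro bounded_linear_intro[where K = K])
      (auto simp: scaleR_scaleC scaleC intro: dual_eqI)
  with scaleC show ?thesis by (simp add: bounded_clinear_def)
qed

lemma second_dual_map_bidual_embed:
  assumes "bounded_clinear T"
  shows "dual_map (dual_map T) (bidual_embed c) = bidual_embed (T c)"
  by (rule dual_eqI)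
    (simp add: dual_apply_dual_map assms bounded_clinear_dual_map bidual_embed.rep_eq)

text \<open>The Arens product is built in three stages, and multiplicativity of \<open>T\<close> passes through
  them one after another: \<open>T\<^sup>* f \<cdot> a = T\<^sup>* (f \<cdot> T a)\<close> gives
  \<open>\<Psi> \<cdot> T\<^sup>* f = T\<^sup>* (T\<^sup>*\<^sup>* \<Psi> \<cdot> f)\<close>, and evaluating \<open>\<Phi>\<close> there gives the claim.\<close>

lemma second_dual_map_arens:
  assumes m: "bounded_cbilinear m" and n: "bounded_cbilinear n"
    and T: "bounded_clinear T" and hom: "\<And>a b. T (m a b) = n (T a) (T b)"
  shows "dual_map (dual_map T) (arens m \<Phi> \<Psi>) =
    arens n (dual_map (dual_map T) \<Phi>) (dual_map (dual_map T) \<Psi>)"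
proof -
  note [simp] = dual_apply_dual_map[OF T] dual_apply_dual_map[OF bounded_clinear_dual_map[OF T]]
  have act: "dual_act m (dual_map T f) a = dual_map T (dual_act n f (T a))" for f a
    by (rule dual_eqI) (simp add: dual_apply_dual_act m n hom)
  have biact: "bidual_act m \<Psi> (dual_map T f) =
      dual_map T (bidual_act n (dual_map (dual_map T) \<Psi>) f)" for f
    by (rule dual_eqI) (simp add: dual_apply_bidual_act m n act)
  show ?thesis
    by (rule dual_eqI) (simp add: dual_apply_arens m n biact)
qed

lemma has_ultra_central_approximate_identity_surj_hom:
  assumes m: "bounded_cbilinear m" and n: "bounded_cbilinear n"
    and T: "bounded_clinear T" and hom: "\<And>a b. T (m a b) = n (T a) (T b)" and surj: "surj T"
    and ucai: "has_ultra_central_approximate_identity TYPE('i) m"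
  shows "has_ultra_central_approximate_identity TYPE('i) n"
proof -
  define T2 where "T2 = dual_map (dual_map T)"
  have arens: "T2 (arens m \<Phi> \<Psi>) = arens n (T2 \<Phi>) (T2 \<Psi>)" for \<Phi> \<Psi>
    unfolding T2_def by (intro second_dual_map_arens m n T hom)
  have embed: "T2 (bidual_embed c) = bidual_embed (T c)" for c
    unfolding T2_def by (rule second_dual_map_bidual_embed[OF T])
  have T2: "bounded_linear T2"
    using bounded_clinear_dual_map[OF bounded_clinear_dual_map[OF T]]
    by (simp add: T2_def bounded_clinear_def)
  obtain I :: "'i set" and le e where dir: "directed_set I le"
    and central: "\<And>\<alpha> c. \<alpha> \<in> I \<Longrightarrow> arens m (bidual_embed c) (e \<alpha>) = arens m (e \<alpha>) (bidual_embed c)"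
    and approx: "\<And>c. ((\<lambda>\<alpha>. arens m (e \<alpha>) (bidual_embed c)) \<longlongrightarrow> bidual_embed c) (tail_filter I le)"
    using ucai unfolding has_ultra_central_approximate_identity_def by blast
  have "arens n (bidual_embed d) (T2 (e \<alpha>)) = arens n (T2 (e \<alpha>)) (bidual_embed d)"
    if "\<alpha> \<in> I" for \<alpha> d
  proof -
    obtain c where "d = T c" using surj by (elim surjE)
    then show ?thesis using central[OF that, of c] by (metis arens embed)
  qed
  moreover have "((\<lambda>\<alpha>. arens n (T2 (e \<alpha>)) (bidual_embed d)) \<longlongrightarrow> bidual_embed d) (tail_filter I le)"
    for d
  proof -
    obtain c where "d = T c" using surj by (elim surjE)
    then show ?thesis
      using bounded_linear.tendsto[OF T2 approx[of c]] by (simp add: arens embed)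
  qed
  ultimately show ?thesis
    unfolding has_ultra_central_approximate_identity_def
    by (intro exI[of _ I] exI[of _ le] exI[of _ "\<lambda>\<alpha>. T2 (e \<alpha>)"]) (use dir in auto)
qed

lemma bounded_clinear_ext_alg:
  "bounded_clinear (ext_alg :: ('a::complex_normed_vector, 'x::complex_normed_vector) module_ext \<Rightarrow> 'a)"
  unfolding bounded_clinear_def
  by (intro conjI allI bounded_linear_intro[where K = 1])
    (auto simp: plus_module_ext_def scaleR_module_ext_def scaleC_module_ext_def norm_module_ext_def)

theorem proposition5p7:
  fixes lact :: "'a::complex_banach_algebra \<Rightarrow> 'x::{complex_normed_vector, banach} \<Rightarrow> 'x"
    and ract :: "'x \<Rightarrow> 'a \<Rightarrow> 'x"
  assumes "commutative_banach_bimodule lact ract"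
    and "has_ultra_central_approximate_identity TYPE('i) (module_ext_mult lact ract)"
  shows "has_ultra_central_approximate_identity TYPE('i) ((*) :: 'a \<Rightarrow> 'a \<Rightarrow> 'a)"
proof (rule has_ultra_central_approximate_identity_surj_hom)
  show "bounded_cbilinear (module_ext_mult lact ract)"
    using assms(1) by (intro bounded_cbilinear_module_ext_mult)
      (simp add: commutative_banach_bimodule_def)
  show "ext_alg (module_ext_mult lact ract u v) = ext_alg u * ext_alg v" for u v
    by (simp add: module_ext_mult_def)
  show "surj (ext_alg :: ('a, 'x) module_ext \<Rightarrow> 'a)"
    by (rule surjI[of _ "\<lambda>a. Ext a 0"]) simp
qed (rule bounded_cbilinear_times bounded_clinear_ext_alg assms(2))+

end
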